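(* For every sequence $a=(a_n)_{n\ge 1}$ of positive real numbers with $\|a\|_1=\sum_{n=1}^\infty a_n<\infty$, one has $$\sum_{n=1}^{\infty} \mathfrak{M}_{2,1,0}(a_1,\ldots,a_n) < 4\,\|a\|_1 .$$ In particular, $\mathfrak{M}_{2,1,0}$ is a Hardy mean.
   Context: Power means: for $p\in\mathbb{R}\cup\{\pm\infty\}$ and a vector $(v_1,\ldots,v_n)$ with all components positive, $\mathfrak{N}_p(v_1,\ldots,v_n)$ equals $\left(\frac1n\sum_{i=1}^n v_i^p\right)^{1/p}$ if $p\in\mathbb{R}\setminus\{0\}$, $\left(\prod_{i=1}^n v_i\right)^{1/n}$ if $p=0$, $\min(v_1,\ldots,v_n)$ if $p=-\infty$, and $\max(v_1,\ldots,v_n)$ if $p=\infty$. Generalized power means: for a positive integer $k$, $s,q\in\mathbb{R}\cup\{\pm\infty\}$ and a vector $(v_1,\ldots,v_n)$ of positive reals, define $\mathfrak{M}_{k,s,q}(v_1,\ldots,v_n)$ as follows. If $k\ge n$, it equals $\mathfrak{N}_q(v_1,\ldots,v_n)$. If $k<n$, it equals the power mean $\mathfrak{N}_s$ of the vector of length $\binom{n}{k}$ whose entries are the numbers $\mathfrak{N}_q(v_{i_1},\ldots,v_{i_k})$, one for each $k$-element subset $\{i_1,\ldots,i_k\}\subset\{1,\ldots,n\}$. Hardy mean: a mean $\mathfrak{A}$ (defined on vectors of positive reals of every length $n\ge1$) is a Hardy mean if there exists a constant $C$ such that $\sum_{n=1}^\infty \mathfrak{A}(a_1,\ldots,a_n)<C\|a\|_1$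 for every sequence $a=(a_n)_{n\ge1}$ of positive reals with $\|a\|_1=\sum_{n=1}^\infty a_n<\infty$. *)

theory Defs
  imports "HOL-Analysis.Analysis"
begin

(* The power mean of the family (v i), i \<in> I, for a finite nonempty index set I and positive
   entries. Indexing by a set lets the same definition apply to vectors (I an initial segment of
   the naturals) and to families indexed by the k-element subsets of such a segment. *)
definition power_mean :: "ereal \<Rightarrow> 'i set \<Rightarrow> ('i \<Rightarrow> real) \<Rightarrow> real" where
  "power_mean p I v =
     (if p = \<infinity> then Max (v ` I)
      else if p = -\<infinity> then Min (v ` I)
      else if p = 0 then (\<Prod>i\<in>I. v i) powr (1 / real (card I))
      else ((\<Sum>i\<in>I. v i powr real_of_ereal p) / real (card I)) powr (1 / real_of_ereal p))"

(* A vector of positive reals is a nonempty list; it has entries xs ! 0, ..., xs ! (n - 1).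
   In the case k < n the outer mean runs over index sets S, so that coinciding entries of xs
   are counted with multiplicity. Only k > 0 is meaningful. *)
definition gen_power_mean :: "nat \<Rightarrow> ereal \<Rightarrow> ereal \<Rightarrow> real list \<Rightarrow> real" where
  "gen_power_mean k s q xs =
     (let n = length xs in
      if n \<le> k then power_mean q {..<n} (\<lambda>i. xs ! i)
      else power_mean s {S. S \<subseteq> {..<n} \<and> card S = k} (\<lambda>S. power_mean q S (\<lambda>i. xs ! i)))"

(* Sequences are indexed from 0, so a n stands for the (n+1)-st term and map a [0..<Suc n] for
   the vector of the first n+1 terms. Since suminf of a divergent series is unspecified, finiteness
   of the sum of the means is stated explicitly. *)
definition hardy_mean :: "(real list \<Rightarrow> real) \<Rightarrow> bool" where
  "hardy_mean A \<longleftrightarrow>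
     (\<exists>C. \<forall>a :: nat \<Rightarrow> real. (\<forall>n. a n > 0) \<longrightarrow> summable a \<longrightarrow>
        summable (\<lambda>n. A (map a [0..<Suc n])) \<and>
        (\<Sum>n. A (map a [0..<Suc n])) < C * (\<Sum>n. a n))"

end

theory Submission
  imports Defs
begin

text \<open>
  Put \<open>b\<^sub>i = sqrt a\<^sub>i\<close> and \<open>S\<^sub>n = b\<^sub>1 + \<dots> + b\<^sub>n\<close>. The mean of a vector of length \<open>n \<ge> 2\<close> is the
  average of the products \<open>b\<^sub>i b\<^sub>j\<close> over the \<open>n (n - 1) / 2\<close> pairs \<open>i < j \<le> n\<close>. Since
  \<open>1 / (n (n - 1)) = 1 / (n - 1) - 1 / n\<close>, the weights that a given pair \<open>i < j\<close> receives for
  \<open>n = j, j + 1, \<dots>\<close> telescope to \<open>2 / (j - 1)\<close>. Summing over the pairs, the means add up to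
  \<open>a\<^sub>1 + 2 \<Sum> b\<^sub>n\<^sub>+\<^sub>1 S\<^sub>n / n\<close>.
  By \<open>2 b x \<le> 2 b\<^sup>2 + x\<^sup>2 / 2\<close> and Hardy's inequality \<open>\<Sum> (S\<^sub>n / n)\<^sup>2 \<le> 4 \<Sum> b\<^sub>n\<^sup>2\<close> this is at most
  \<open>a\<^sub>1 + 2 (\<Sum> a\<^sub>n - a\<^sub>1) + 2 \<Sum> a\<^sub>n = 4 \<Sum> a\<^sub>n - a\<^sub>1\<close>. The shift of the index in \<open>b\<^sub>n\<^sub>+\<^sub>1\<close> loses the
  first term twice while it is added only once, and this is what makes the inequality strict.

  Indices start from 0 below, so that \<open>sum b {..<n}\<close> is \<open>S\<^sub>n\<close>. The argument is carried out for
  partial sums, where the telescoping (\<open>sum_pair_averages\<close>) leaves a nonpositive boundary term and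
  Hardy's inequality (\<open>hardy_inequality_finite\<close>) has an inductive proof.
\<close>

text \<open>
  The boundary term on the left makes the induction work. With \<open>x\<^sub>n = S\<^sub>n / n\<close>, the step from
  \<open>n\<close> to \<open>n + 1\<close> says, after substituting \<open>b\<^sub>n = (n + 1) x\<^sub>n\<^sub>+\<^sub>1 - n x\<^sub>n\<close>, that a quadratic form in
  \<open>x\<^sub>n\<close> and \<open>x\<^sub>n\<^sub>+\<^sub>1\<close> is nonnegative, and this form is a sum of two squares.
\<close>
lemma hardy_inequality_finite:
  fixes b :: "nat \<Rightarrow> real"
  shows "(\<Sum>n<N. (sum b {..<Suc n} / real (Suc n))\<^sup>2) + 2 * real N * (sum b {..<N} / real N)\<^sup>2
           \<le> 4 * (\<Sum>n<N. (b n)\<^sup>2)"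
proof (induction N)
  case 0
  show ?case by simp
next
  case (Suc N)
  define x where "x = sum b {..<N} / real N"
  define y where "y = sum b {..<Suc N} / real (Suc N)"
  have "real N * x = sum b {..<N}"
    by (simp add: x_def)
  moreover have "real (Suc N) * y = sum b {..<Suc N}"
    by (simp add: y_def del: of_nat_Suc)
  ultimately have b: "b N = (real N + 1) * y - real N * x"
    by (simp add: algebra_simps)
  have "4 * (b N)\<^sup>2 + 2 * real N * x\<^sup>2 - y\<^sup>2 - 2 * (real N + 1) * y\<^sup>2
          = (2 * b N - y)\<^sup>2 + 2 * real N * (x - y)\<^sup>2"
    unfolding b by (simp add: power2_eq_square algebra_simps)
  moreover have "0 \<le> (2 * b N - y)\<^sup>2 + 2 * real N * (x - y)\<^sup>2"
    by simp
  ultimately have "y\<^sup>2 + 2 * (real N + 1) * y\<^sup>2 \<le> 4 * (b N)\<^sup>2 + 2 * real N * x\<^sup>2"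
    by linarith
  moreover have "(\<Sum>n<N. (sum b {..<Suc n} / real (Suc n))\<^sup>2) + 2 * real N * x\<^sup>2
                   \<le> 4 * (\<Sum>n<N. (b n)\<^sup>2)"
    using Suc.IH unfolding x_def .
  moreover have "(\<Sum>n<Suc N. (sum b {..<Suc n} / real (Suc n))\<^sup>2)
                   + 2 * real (Suc N) * (sum b {..<Suc N} / real (Suc N))\<^sup>2
                 = (\<Sum>n<N. (sum b {..<Suc n} / real (Suc n))\<^sup>2) + y\<^sup>2 + 2 * (real N + 1) * y\<^sup>2"
    unfolding y_def sum.lessThan_Suc[of "\<lambda>n. (sum b {..<Suc n} / real (Suc n))\<^sup>2"] by simp
  moreover have "4 * (\<Sum>n<Suc N. (b n)\<^sup>2) = 4 * (\<Sum>n<N. (b n)\<^sup>2) + 4 * (b N)\<^sup>2"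
    by simp
  ultimately show ?case by linarith
qed

definition pair_sum :: "(nat \<Rightarrow> real) \<Rightarrow> nat \<Rightarrow> real" where
  "pair_sum b n = (\<Sum>j<n. b j * sum b {..<j})"

lemma pair_sum_Suc: "pair_sum b (Suc n) = pair_sum b n + b n * sum b {..<n}"
  by (simp add: pair_sum_def)

text \<open>Two-element sets are grouped by their larger element \<open>j\<close>.\<close>
lemma sum_two_subsets_eq_pair_sum:
  "(\<Sum>S | S \<subseteq> {..<n} \<and> card S = 2. \<Prod>i\<in>S. b i) = pair_sum b n"
proof (induction n)
  case 0
  have none: "{S. S \<subseteq> {..<0::nat} \<and> card S = 2} = {}" by auto
  show ?case unfolding none by (simp add: pair_sum_def)
next
  case (Suc n)
  let ?P = "\<lambda>m::nat. {S. S \<subseteq> {..<m} \<and> card S = 2}"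
  let ?Q = "(\<lambda>i. {i, n}) ` {..<n}"
  have "?P (Suc n) \<subseteq> ?P n \<union> ?Q"
  proof
    fix S assume "S \<in> ?P (Suc n)"
    then have "S \<subseteq> {..<Suc n}" "card S = 2" by auto
    then obtain i j where S: "S = {i, j}" "i \<noteq> j" "i < Suc n" "j < Suc n"
      by (auto simp: card_2_iff)
    consider "i < n" "j < n" | "i = n" "j < n" | "j = n" "i < n"
      using S by linarith
    then show "S \<in> ?P n \<union> ?Q"
    proof cases
      case 1
      then show ?thesis using S by simp
    next
      case 2
      then have "S = {j, n}" using S(1) by (simp only: insert_commute)
      then show ?thesis using 2 by blast
    next
      case 3
      then show ?thesis using S(1) by blast
    qed
  qed
  moreover have "?P n \<union> ?Q \<subseteq> ?P (Suc n)"
    by auto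
  ultimately have split: "?P (Suc n) = ?P n \<union> ?Q" by (rule equalityI)
  have inj: "inj_on (\<lambda>i. {i, n}) {..<n}"
    by (auto simp: inj_on_def doubleton_eq_iff)
  have "sum (prod b) (?P (Suc n)) = sum (prod b) (?P n) + sum (prod b) ?Q"
    unfolding split by (rule sum.union_disjoint) auto
  also have "sum (prod b) ?Q = (\<Sum>i<n. b i * b n)"
    unfolding sum.reindex[OF inj] by (rule sum.cong) auto
  also have "\<dots> = b n * sum b {..<n}"
    by (simp add: sum_distrib_left mult.commute)
  finally show ?case
    using Suc.IH by (simp only: pair_sum_Suc)
qed

text \<open>
  This is the telescoping of the weights \<open>1 / (n (n - 1))\<close>. The term for \<open>n = 0\<close> on the left and
  the term for \<open>j = 0\<close> on the right vanish.
\<close>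
lemma sum_pair_averages:
  "(\<Sum>n<Suc N. 2 * pair_sum b (Suc n) / (real (Suc n) * real n))
     = 2 * (\<Sum>j<Suc N. b j * sum b {..<j} / real j) - 2 * pair_sum b (Suc N) / real (Suc N)"
proof (induction N)
  case 0
  show ?case by (simp add: pair_sum_def)
next
  case (Suc N)
  let ?M = "\<lambda>n. 2 * pair_sum b (Suc n) / (real (Suc n) * real n)"
  let ?c = "\<lambda>j. b j * sum b {..<j} / real j"
  let ?P = "pair_sum b (Suc (Suc N))"
  have "?M (Suc N) = 2 * ?P / real (Suc N) - 2 * ?P / real (Suc (Suc N))"
    by (simp add: divide_simps) (simp add: algebra_simps)
  also have "2 * ?P / real (Suc N) = 2 * pair_sum b (Suc N) / real (Suc N) + 2 * ?c (Suc N)"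
    unfolding pair_sum_Suc[of b "Suc N"] by (simp only: distrib_left add_divide_distrib times_divide_eq_right)
  finally have step: "?M (Suc N) = 2 * pair_sum b (Suc N) / real (Suc N) + 2 * ?c (Suc N)
                                     - 2 * ?P / real (Suc (Suc N))" .
  show ?case
    unfolding sum.lessThan_Suc[of ?M "Suc N"] sum.lessThan_Suc[of ?c "Suc N"] Suc.IH step
    by (simp only: algebra_simps)
qed

text \<open>
  Each \<open>b\<^sub>j\<close> is paired with the preceding mean \<open>S\<^sub>j / j\<close>. Young's inequality with the weights
  \<open>2 b x \<le> 2 b\<^sup>2 + x\<^sup>2 / 2\<close> gives half of the constant 4 to each factor, because the sum of the \<open>x\<^sup>2\<close>
  is at most 4 times that of the \<open>b\<^sup>2\<close>. The subtracted term appears because \<open>b\<^sub>0\<close> has no preceding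
  mean.
\<close>
lemma cross_terms_le:
  fixes b :: "nat \<Rightarrow> real"
  shows "2 * (\<Sum>j<Suc N. b j * sum b {..<j} / real j) \<le> 4 * (\<Sum>n<Suc N. (b n)\<^sup>2) - 2 * (b 0)\<^sup>2"
proof -
  define x where "x = (\<lambda>n. sum b {..<Suc n} / real (Suc n))"
  have young: "2 * (b (Suc n) * x n) \<le> 2 * (b (Suc n))\<^sup>2 + (x n)\<^sup>2 / 2" for n
  proof -
    have "0 \<le> (2 * b (Suc n) - x n)\<^sup>2" by simp
    then show ?thesis by (simp add: power2_eq_square algebra_simps)
  qed
  have "2 * (\<Sum>j<Suc N. b j * sum b {..<j} / real j) = (\<Sum>n<N. 2 * (b (Suc n) * x n))"
    unfolding sum.lessThan_Suc_shift[of "\<lambda>j. b j * sum b {..<j} / real j"]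
    by (simp add: x_def sum_distrib_left)
  also have "\<dots> \<le> (\<Sum>n<N. 2 * (b (Suc n))\<^sup>2 + (x n)\<^sup>2 / 2)"
    by (intro sum_mono young)
  also have "\<dots> = 2 * (\<Sum>n<N. (b (Suc n))\<^sup>2) + (\<Sum>n<N. (x n)\<^sup>2) / 2"
    by (simp add: sum.distrib sum_distrib_left sum_divide_distrib)
  also have "(\<Sum>n<N. (x n)\<^sup>2) \<le> 4 * (\<Sum>n<N. (b n)\<^sup>2)"
  proof -
    have "0 \<le> 2 * real N * (sum b {..<N} / real N)\<^sup>2" by simp
    then show ?thesis
      using hardy_inequality_finite[of b N] unfolding x_def by linarith
  qed
  also have "(\<Sum>n<N. (b n)\<^sup>2) \<le> (\<Sum>n<Suc N. (b n)\<^sup>2)"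
    by simp
  also have "(\<Sum>n<N. (b (Suc n))\<^sup>2) = (\<Sum>n<Suc N. (b n)\<^sup>2) - (b 0)\<^sup>2"
    unfolding sum.lessThan_Suc_shift by simp
  finally have "2 * (\<Sum>j<Suc N. b j * sum b {..<j} / real j)
                  \<le> 2 * ((\<Sum>n<Suc N. (b n)\<^sup>2) - (b 0)\<^sup>2) + 4 * (\<Sum>n<Suc N. (b n)\<^sup>2) / 2"
    by simp
  then show ?thesis by (simp only: right_diff_distrib)
qed

lemma geometric_mean_pair:
  assumes "card S = 2" and nonneg: "\<And>i. i \<in> S \<Longrightarrow> 0 \<le> v i"
  shows "power_mean 0 S v = (\<Prod>i\<in>S. sqrt (v i))"
proof -
  obtain i j where S: "S = {i, j}" "i \<noteq> j"
    using assms(1) by (auto simp: card_2_iff)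
  then have "0 \<le> v i * v j"
    using nonneg by simp
  then show ?thesis
    using S by (simp add: power_mean_def powr_half_sqrt real_sqrt_mult)
qed

text \<open>
  The first summand accounts for vectors of length 1: there the mean is the entry itself and no pair
  exists, so that the second summand vanishes. For length 2 the mean is defined as a geometric mean, which is also the average over the only pair.
\<close>
lemma gen_power_mean_2_1_0:
  assumes nonneg: "\<And>n. 0 \<le> a n"
  shows "gen_power_mean 2 1 0 (map a [0..<Suc n])
           = (if n = 0 then a 0 else 0)
             + 2 * pair_sum (\<lambda>i. sqrt (a i)) (Suc n) / (real (Suc n) * real n)"
proof -
  let ?xs = "map a [0..<Suc n]"
  let ?b = "\<lambda>i. sqrt (a i)"
  have nth: "?xs ! i = a i" if "i < Suc n" for i
    using that by (simp del: upt_Suc)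
  have pair: "power_mean 0 S (\<lambda>i. ?xs ! i) = (\<Prod>i\<in>S. ?b i)"
    if S: "S \<subseteq> {..<Suc n}" "card S = 2" for S
  proof -
    have entry: "?xs ! i = a i" if "i \<in> S" for i
      using nth that S by blast
    have "power_mean 0 S (\<lambda>i. ?xs ! i) = (\<Prod>i\<in>S. sqrt (?xs ! i))"
      by (rule geometric_mean_pair[OF S(2)]) (simp only: entry nonneg)
    also have "\<dots> = (\<Prod>i\<in>S. ?b i)"
      by (intro prod.cong refl) (simp only: entry)
    finally show ?thesis .
  qed
  consider "n = 0" | "n = 1" | "2 \<le> n" by linarith
  then show ?thesis
  proof cases
    case 1
    then show ?thesis
      using nonneg by (simp add: gen_power_mean_def power_mean_def pair_sum_def)
  next
    case 2
    then have "gen_power_mean 2 1 0 ?xs = power_mean 0 {..<2} (\<lambda>i. ?xs ! i)"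
      by (simp add: gen_power_mean_def numeral_2_eq_2)
    also have "\<dots> = (\<Prod>i<2. ?b i)"
      by (rule pair) (use 2 in auto)
    finally show ?thesis
      using 2 by (simp add: pair_sum_def numeral_2_eq_2)
  next
    case 3
    let ?P = "{S. S \<subseteq> {..<Suc n} \<and> card S = 2}"
    have len: "length ?xs = Suc n" by simp
    have "gen_power_mean 2 1 0 ?xs = power_mean 1 ?P (\<lambda>S. power_mean 0 S (\<lambda>i. ?xs ! i))"
      unfolding gen_power_mean_def Let_def len using 3 by simp
    also have "\<dots> = ((\<Sum>S\<in>?P. power_mean 0 S (\<lambda>i. ?xs ! i) powr 1) / real (card ?P)) powr 1"
      by (simp add: power_mean_def[of 1])
    also have "(\<Sum>S\<in>?P. power_mean 0 S (\<lambda>i. ?xs ! i) powr 1) = (\<Sum>S\<in>?P. \<Prod>i\<in>S. ?b i)"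
    proof (rule sum.cong[OF refl])
      fix S assume "S \<in> ?P"
      then have "power_mean 0 S (\<lambda>i. ?xs ! i) = (\<Prod>i\<in>S. ?b i)"
        using pair by blast
      then show "power_mean 0 S (\<lambda>i. ?xs ! i) powr 1 = (\<Prod>i\<in>S. ?b i)"
        by (simp only:) (simp add: prod_nonneg nonneg)
    qed
    also have "\<dots> = pair_sum ?b (Suc n)"
      by (rule sum_two_subsets_eq_pair_sum)
    also have "card ?P = Suc n choose 2"
      using n_subsets[of "{..<Suc n}" 2] by simp
    also have "real (Suc n choose 2) = real (Suc n) * real n / 2"
      unfolding choose_two by (simp add: real_of_nat_div algebra_simps)
    also have "(pair_sum ?b (Suc n) / (real (Suc n) * real n / 2)) powr 1
                 = 2 * pair_sum ?b (Suc n) / (real (Suc n) * real n)"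
    proof -
      have "0 \<le> pair_sum ?b (Suc n)"
        unfolding pair_sum_def by (intro sum_nonneg mult_nonneg_nonneg) (auto simp: nonneg)
      then have "(pair_sum ?b (Suc n) / (real (Suc n) * real n / 2)) powr 1
                   = pair_sum ?b (Suc n) / (real (Suc n) * real n / 2)"
        by (intro powr_one) simp
      then show ?thesis by (simp only: divide_divide_eq_right mult.commute)
    qed
    finally show ?thesis using 3 by simp
  qed
qed

lemma gen_power_mean_2_1_0_nonneg:
  assumes "\<And>n. 0 \<le> a n"
  shows "0 \<le> gen_power_mean 2 1 0 (map a [0..<Suc n])"
  unfolding gen_power_mean_2_1_0[OF assms] pair_sum_def
  by (intro add_nonneg_nonneg divide_nonneg_nonneg mult_nonneg_nonneg sum_nonneg)
    (use assms in auto)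

lemma sum_gen_power_mean_2_1_0_le:
  assumes nonneg: "\<And>n. 0 \<le> a n"
  shows "(\<Sum>n<Suc N. gen_power_mean 2 1 0 (map a [0..<Suc n])) \<le> 4 * (\<Sum>n<Suc N. a n) - a 0"
proof -
  let ?b = "\<lambda>i. sqrt (a i)"
  have "(\<Sum>n<Suc N. gen_power_mean 2 1 0 (map a [0..<Suc n]))
          = (\<Sum>n<Suc N. if n = 0 then a 0 else 0)
            + (\<Sum>n<Suc N. 2 * pair_sum ?b (Suc n) / (real (Suc n) * real n))"
    unfolding gen_power_mean_2_1_0[OF nonneg] by (rule sum.distrib)
  also have "(\<Sum>n<Suc N. if n = 0 then a 0 else 0) = a 0"
    unfolding sum.lessThan_Suc_shift by simp
  also have "(\<Sum>n<Suc N. 2 * pair_sum ?b (Suc n) / (real (Suc n) * real n))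
               \<le> 2 * (\<Sum>j<Suc N. ?b j * sum ?b {..<j} / real j)"
  proof -
    have "0 \<le> 2 * pair_sum ?b (Suc N) / real (Suc N)"
      unfolding pair_sum_def
      by (intro divide_nonneg_nonneg mult_nonneg_nonneg sum_nonneg) (use nonneg in auto)
    then show ?thesis unfolding sum_pair_averages by linarith
  qed
  also have "\<dots> \<le> 4 * (\<Sum>n<Suc N. (?b n)\<^sup>2) - 2 * (?b 0)\<^sup>2"
    by (rule cross_terms_le)
  also have "\<dots> = 4 * (\<Sum>n<Suc N. a n) - 2 * a 0"
    using nonneg by simp
  finally show ?thesis by simp
qed

lemma gen_power_mean_2_1_0_hardy:
  fixes a :: "nat \<Rightarrow> real"
  assumes pos: "\<And>n. 0 < a n" and "summable a"
  shows "summable (\<lambda>n. gen_power_mean 2 1 0 (map a [0..<Suc n]))"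
    and "(\<Sum>n. gen_power_mean 2 1 0 (map a [0..<Suc n])) < 4 * (\<Sum>n. a n)"
proof -
  let ?m = "\<lambda>n. gen_power_mean 2 1 0 (map a [0..<Suc n])"
  have nonneg: "0 \<le> a n" for n
    using pos[of n] by simp
  have m_nonneg: "0 \<le> ?m n" for n
    by (rule gen_power_mean_2_1_0_nonneg[OF nonneg])
  have bound: "sum ?m {..<N} \<le> 4 * suminf a - a 0" for N
  proof -
    have "sum ?m {..<N} \<le> sum ?m {..<Suc N}"
      unfolding sum.lessThan_Suc using m_nonneg[of N] by linarith
    also have "\<dots> \<le> 4 * sum a {..<Suc N} - a 0"
      by (rule sum_gen_power_mean_2_1_0_le[OF nonneg])
    also have "sum a {..<Suc N} \<le> suminf a"
      by (rule sum_le_suminf[OF \<open>summable a\<close>]) (simp_all add: nonneg)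
    finally show ?thesis by simp
  qed
  show summable: "summable ?m"
    by (rule summableI_nonneg_bounded[OF m_nonneg bound])
  have "suminf ?m \<le> 4 * suminf a - a 0"
    by (rule suminf_le_const[OF summable bound])
  then show "suminf ?m < 4 * suminf a"
    using pos[of 0] by linarith
qed

theorem theorem1:
  shows "(\<forall>a :: nat \<Rightarrow> real. (\<forall>n. a n > 0) \<longrightarrow> summable a \<longrightarrow>
            summable (\<lambda>n. gen_power_mean 2 1 0 (map a [0..<Suc n])) \<and>
            (\<Sum>n. gen_power_mean 2 1 0 (map a [0..<Suc n])) < 4 * (\<Sum>n. a n))
         \<and> hardy_mean (gen_power_mean 2 1 0)"
  unfolding hardy_mean_def
  by (intro conjI exI[of _ 4] allI impI) (simp_all only: gen_power_mean_2_1_0_hardy)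

end
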